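(* For every integer $c\geq 4$, the graph $\Gamma(1,4,c,c)$ has avoidance index $2$.
   Context: For integers $0\le a\le b\le c\le d$, $\Gamma(a,b,c,d)$ is the graph consisting of two vertices $u,v$ (each of valency 4) joined by four internally vertex-disjoint paths A, B, C, D having respectively $a,b,c,d$ internal vertices (all of valency 2). An Eulerian circuit is a closed trail traversing every edge exactly once. For an Eulerian graph with $m$ edges and vertex $x$, two Eulerian circuits $x,v_1,\ldots,v_{m-1},x$ and $x,w_1,\ldots,w_{m-1},x$ are avoiding if for each $1\le i\le m-1$, $v_i\ne w_i$ and $v_i,w_i$ are non-adjacent; a set of Eulerian circuits is mutually avoiding if they are pairwise avoiding. The avoidance index $\mathrm{av}(G)$ of an Eulerian graph $G$ is the largest $k$ such that for every vertex $x$ there is a set of $k$ mutually avoiding Eulerian circuits starting and ending at $x$. *)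

theory Defs
  imports Main "HOL-Library.Multiset"
begin

(* Undirected multigraphs.  Edges are the two-element sets of their end
   vertices, counted with multiplicity: Gamma 0 0 c d has parallel edges. *)
record 'a multigraph =
  verts :: "'a set"
  edges :: "'a set multiset"

definition adjacent :: "'a multigraph \<Rightarrow> 'a \<Rightarrow> 'a \<Rightarrow> bool" where
  "adjacent G v w \<longleftrightarrow> {v, w} \<in># edges G"

definition walk_edges :: "'a list \<Rightarrow> 'a set list" where
  "walk_edges p = map (\<lambda>(v, w). {v, w}) (zip p (tl p))"

(* An Eulerian circuit is given by its full vertex sequence
   [x, v_1, ..., v_(m-1), x], with both ends included.  The multiset equation
   says that every edge is traversed exactly once, so the length is m + 1. *)
definition eulerian_circuit :: "'a multigraph \<Rightarrow> 'a \<Rightarrow> 'a list \<Rightarrow> bool" where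
  "eulerian_circuit G x p \<longleftrightarrow>
     p \<noteq> [] \<and> hd p = x \<and> last p = x \<and> set p \<subseteq> verts G \<and>
     mset (walk_edges p) = edges G"

definition avoiding :: "'a multigraph \<Rightarrow> 'a list \<Rightarrow> 'a list \<Rightarrow> bool" where
  "avoiding G p q \<longleftrightarrow>
     (\<forall>i\<in>{1..size (edges G) - 1}. p ! i \<noteq> q ! i \<and> \<not> adjacent G (p ! i) (q ! i))"

definition has_avoiding_circuits :: "'a multigraph \<Rightarrow> 'a \<Rightarrow> nat \<Rightarrow> bool" where
  "has_avoiding_circuits G x k \<longleftrightarrow>
     (\<exists>S. finite S \<and> card S = k \<and> (\<forall>p\<in>S. eulerian_circuit G x p) \<and>
          pairwise (avoiding G) S)"

(* Meant for finite Eulerian graphs with at least one edge.  There the maximum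
   exists, since a vertex x starts only finitely many Eulerian circuits. *)
definition avoidance_index :: "'a multigraph \<Rightarrow> nat" where
  "avoidance_index G = (GREATEST k. \<forall>x\<in>verts G. has_avoiding_circuits G x k)"

datatype branch = A | B | C | D

(* Internal i j is the j-th internal vertex of branch i, counted from Hub_u. *)
datatype gamma_vertex = Hub_u | Hub_v | Internal branch nat

definition branch_path :: "branch \<Rightarrow> nat \<Rightarrow> gamma_vertex list" where
  "branch_path i n = Hub_u # map (Internal i) [0..<n] @ [Hub_v]"

definition Gamma :: "nat \<Rightarrow> nat \<Rightarrow> nat \<Rightarrow> nat \<Rightarrow> gamma_vertex multigraph" where
  "Gamma a b c d =
     \<lparr> verts = set (branch_path A a) \<union> set (branch_path B b) \<union>
               set (branch_path C c) \<union> set (branch_path D d),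
       edges = mset (walk_edges (branch_path A a)) + mset (walk_edges (branch_path B b)) +
               mset (walk_edges (branch_path C c)) + mset (walk_edges (branch_path D d)) \<rparr>"

end

theory Submission
  imports Defs
begin

text \<open>
  The internal vertex of branch A has only two neighbours, and mutually avoiding circuits must
  leave it towards different neighbours, so at most two of them start there.  Conversely, for
  every start vertex one takes a circuit leaving along its branch towards v and one leaving
  towards u, which then traverse the other three branches in suitably chosen orders; two circuits
  never come close unless they are near a common hub at the same time or meet inside a common
  branch, and both are excluded by comparing times.  For a start vertex on a branch with c
  internal vertices, the choice of orders depends only on how far it is from the middle of that
  branch.
\<close>

section \<open>Edges of concatenated and reversed walks\<close>

lemma walk_edges_simps [simp]:
  "walk_edges [] = []" "walk_edges [x] = []"
  "walk_edges (x # y # zs) = {x, y} # walk_edges (y # zs)"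
  by (simp_all add: walk_edges_def)

text \<open>The walks share the joint vertex and \<open>tl q\<close> drops its second copy, so no
  edge is added or lost there.\<close>

lemma walk_edges_join:
  assumes "p \<noteq> []" "q \<noteq> []" "last p = hd q"
  shows "walk_edges (p @ tl q) = walk_edges p @ walk_edges q"
  using assms
proof (induction p rule: induct_list012)
  case (2 x)
  then show ?case by (cases q) auto
qed auto

lemma mset_walk_edges_rev: "mset (walk_edges (rev p)) = mset (walk_edges p)"
proof (induction p rule: induct_list012)
  case (3 x y zs)
  have "walk_edges (rev (y # zs) @ tl [y, x]) = walk_edges (rev (y # zs)) @ walk_edges [y, x]"
    by (rule walk_edges_join) auto
  with 3 show ?case
    by (simp add: insert_commute)
qed auto

text \<open>The shift is \<open>length xs - 1\<close> because the joint vertex is kept once, as the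
  last entry of \<open>xs\<close>.\<close>

lemma nth_join:
  assumes "xs \<noteq> []" "ys \<noteq> []" "last xs = hd ys"
  shows "(xs @ tl ys) ! t = (if t < length xs then xs ! t else ys ! (t - (length xs - 1)))"
    and "last (xs @ tl ys) = last ys" and "hd (xs @ tl ys) = hd xs"
proof -
  obtain y zs where ys: "ys = y # zs"
    using assms(2) by (cases ys) auto
  show "(xs @ tl ys) ! t = (if t < length xs then xs ! t else ys ! (t - (length xs - 1)))"
    using assms(1) by (cases xs) (auto simp: ys nth_append nth_Cons' Suc_diff_le)
  show "last (xs @ tl ys) = last ys" "hd (xs @ tl ys) = hd xs"
    using assms by (auto simp: ys)
qed

section \<open>Eulerian circuits and avoidance in arbitrary multigraphs\<close>

lemma eulerian_circuitD:
  assumes "eulerian_circuit G x p"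
  shows "length p = Suc (size (edges G))" "p ! 0 = x"
    and "Suc i < length p \<Longrightarrow> adjacent G (p ! i) (p ! Suc i)"
proof -
  have ne: "p \<noteq> []" and eq: "mset (walk_edges p) = edges G"
    using assms by (auto simp: eulerian_circuit_def)
  have "size (edges G) = length (walk_edges p)"
    by (simp flip: eq)
  then show "length p = Suc (size (edges G))"
    using ne by (cases p) (auto simp: walk_edges_def)
  show "p ! 0 = x"
    using assms by (auto simp: eulerian_circuit_def hd_conv_nth)
  assume "Suc i < length p"
  then have "walk_edges p ! i = {p ! i, p ! Suc i}" "i < length (walk_edges p)"
    by (auto simp: walk_edges_def nth_tl)
  then show "adjacent G (p ! i) (p ! Suc i)"
    unfolding adjacent_def eq[symmetric] by (metis nth_mem set_mset_mset)
qed

text \<open>At time 1 every circuit stands on a neighbour of \<open>x\<close>, and avoiding circuits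
  stand on different ones. Having at least two edges puts time 1 into the compared range.\<close>

lemma has_avoiding_circuits_le_degree:
  assumes "has_avoiding_circuits G x k" "size (edges G) \<ge> 2"
    and N: "finite N" "{y. adjacent G x y} \<subseteq> N"
  shows "k \<le> card N"
proof -
  obtain S where S: "finite S" "card S = k" "\<And>p. p \<in> S \<Longrightarrow> eulerian_circuit G x p"
    "pairwise (avoiding G) S"
    using assms(1) by (auto simp: has_avoiding_circuits_def)
  have "inj_on (\<lambda>p. p ! 1) S"
  proof (rule inj_onI, rule ccontr)
    fix p q assume "p \<in> S" "q \<in> S" "p ! 1 = q ! 1" "p \<noteq> q"
    moreover have "(1::nat) \<in> {1..size (edges G) - 1}"
      using assms(2) by auto
    ultimately show False
      using S(4) unfolding pairwise_def avoiding_def by blast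
  qed
  moreover have "(\<lambda>p. p ! 1) ` S \<subseteq> N"
  proof
    fix y assume "y \<in> (\<lambda>p. p ! 1) ` S"
    then obtain p where p: "p \<in> S" "y = p ! 1" by auto
    have "adjacent G (p ! 0) (p ! Suc 0)"
      using eulerian_circuitD(1,3)[OF S(3)[OF p(1)]] assms(2) by auto
    then show "y \<in> N"
      using eulerian_circuitD(2)[OF S(3)[OF p(1)]] p(2) N(2) by auto
  qed
  ultimately show ?thesis
    using S(2) N(1) card_inj_on_le by metis
qed

lemma has_avoiding_circuits_two:
  assumes "eulerian_circuit G x p" "eulerian_circuit G x q" "avoiding G p q" "size (edges G) \<ge> 2"
  shows "has_avoiding_circuits G x 2"
proof -
  have "avoiding G q p"
    using assms(3) by (auto simp: avoiding_def adjacent_def insert_commute)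
  \<comment> \<open>Needed for \<open>{p, q}\<close> to have cardinality 2; time 1 already separates
    the circuits.\<close>
  moreover have "p \<noteq> q"
  proof
    assume "p = q"
    moreover have "(1::nat) \<in> {1..size (edges G) - 1}"
      using assms(4) by auto
    ultimately show False
      using assms(3) unfolding avoiding_def by blast
  qed
  ultimately show ?thesis
    unfolding has_avoiding_circuits_def
    using assms by (intro exI[of _ "{p, q}"]) (auto simp: pairwise_insert)
qed

section \<open>Coordinates on the four branches\<close>

abbreviation gamma :: "(branch \<Rightarrow> nat) \<Rightarrow> gamma_vertex multigraph" where
  "gamma n \<equiv> Gamma (n A) (n B) (n C) (n D)"

text \<open>Each hub receives a coordinate on every branch, so a walk that passes a hub can still be
  handled by linear arithmetic.\<close>

definition point :: "(branch \<Rightarrow> nat) \<Rightarrow> branch \<Rightarrow> nat \<Rightarrow> gamma_vertex" where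
  "point n X i = (if i = 0 then Hub_u else if i = Suc (n X) then Hub_v else Internal X (i - 1))"

lemma point_0 [simp]: "point n X 0 = Hub_u"
  and point_end [simp]: "point n X (Suc (n X)) = Hub_v"
  by (auto simp: point_def)

lemma branch_path_eq: "branch_path X (n X) = map (point n X) [0..<n X + 2]"
proof (rule nth_equalityI)
  fix i assume "i < length (branch_path X (n X))"
  then show "branch_path X (n X) ! i = map (point n X) [0..<n X + 2] ! i"
    by (cases i) (auto simp: branch_path_def point_def nth_append nth_Cons'
        simp del: upt_Suc)
qed (auto simp: branch_path_def)

definition arc :: "(branch \<Rightarrow> nat) \<Rightarrow> branch \<Rightarrow> nat \<Rightarrow> nat \<Rightarrow> gamma_vertex list" where
  "arc n X i j = map (point n X) [i..<Suc j]"

lemma arc_simps [simp]: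
  assumes "i \<le> j"
  shows "arc n X i j \<noteq> []" "length (arc n X i j) = Suc (j - i)"
    "hd (arc n X i j) = point n X i" "last (arc n X i j) = point n X j"
  using assms by (auto simp: arc_def hd_append hd_map last_map simp del: upt_Suc)

lemma nth_arc: "t \<le> j - i \<Longrightarrow> i \<le> j \<Longrightarrow> arc n X i j ! t = point n X (i + t)"
  and nth_rev_arc: "t \<le> j - i \<Longrightarrow> i \<le> j \<Longrightarrow> rev (arc n X i j) ! t = point n X (j - t)"
  by (auto simp: arc_def rev_nth simp del: upt_Suc)

lemma branch_path_arc: "branch_path X (n X) = arc n X 0 (Suc (n X))"
  by (simp add: branch_path_eq arc_def)

text \<open>Serves to reassemble the start branch, which a circuit covers in two pieces cut at the
  start vertex.\<close>

lemma walk_edges_arc_split: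
  assumes "i \<le> j" "j \<le> k"
  shows "walk_edges (arc n X i k) = walk_edges (arc n X i j) @ walk_edges (arc n X j k)"
proof -
  have "[i..<Suc k] = [i..<Suc j] @ [Suc j..<Suc k]"
    using assms upt_add_eq_append[of i "Suc j" "k - j"] by simp
  moreover have "[j..<Suc k] = j # [Suc j..<Suc k]"
    using assms by (intro upt_conv_Cons) auto
  ultimately have "arc n X i k = arc n X i j @ tl (arc n X j k)"
    by (simp add: arc_def del: upt_Suc)
  then show ?thesis
    using assms by (simp add: walk_edges_join)
qed

text \<open>Any ordering of the branches is allowed, since the circuits below traverse them in
  varying orders.\<close>

lemma edges_gamma:
  assumes "distinct [X, Y, Z, W]"
  shows "edges (gamma n) = mset (walk_edges (branch_path X (n X))) + mset (walk_edges (branch_path Y (n Y)))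
    + mset (walk_edges (branch_path Z (n Z))) + mset (walk_edges (branch_path W (n W)))"
  using assms by (cases X; cases Y; cases Z; cases W) (simp_all add: Gamma_def ac_simps)

lemma size_edges_gamma:
  assumes "distinct [X, Y, Z, W]"
  shows "size (edges (gamma n)) = n X + n Y + n Z + n W + 4"
  unfolding edges_gamma[OF assms] by (simp add: walk_edges_def branch_path_def)

lemma verts_gamma: "verts (gamma n) = {point n X i | X i. i \<le> Suc (n X)}"
proof -
  have "verts (gamma n) = (\<Union>X. set (branch_path X (n X)))"
    unfolding Gamma_def by (auto, metis branch.exhaust)
  also have "\<dots> = {point n X i | X i. i \<le> Suc (n X)}"
    unfolding branch_path_eq by (fastforce simp: less_Suc_eq_le simp del: upt_Suc)
  finally show ?thesis .
qed

lemma adjacent_gammaE: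
  assumes "adjacent (gamma n) v w"
  obtains X i where "i \<le> n X" "{v, w} = {point n X i, point n X (Suc i)}"
proof -
  obtain X where "{v, w} \<in> set (walk_edges (branch_path X (n X)))"
    using assms by (auto simp: adjacent_def Gamma_def)
  then obtain i where i: "i < length (branch_path X (n X)) - 1"
    and e: "{v, w} = walk_edges (branch_path X (n X)) ! i"
    by (auto simp: in_set_conv_nth walk_edges_def)
  then have "{v, w} = {branch_path X (n X) ! i, branch_path X (n X) ! Suc i}"
    by (simp add: walk_edges_def nth_tl)
  then show ?thesis
    using i that[of i X] by (simp add: branch_path_eq del: upt_Suc)
qed

section \<open>Coordinate criteria for being distinct and non-adjacent\<close>

definition separated :: "(branch \<Rightarrow> nat) \<Rightarrow> gamma_vertex \<Rightarrow> gamma_vertex \<Rightarrow> bool" where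
  "separated n v w \<longleftrightarrow> v \<noteq> w \<and> \<not> adjacent (gamma n) v w"

text \<open>Neighbours along one branch have consecutive coordinates. Only the two hubs could be
  joined elsewhere, by a branch without internal vertices, which the first hypothesis
  excludes.\<close>

lemma separated_same:
  assumes "\<forall>X. n X \<ge> 1" "i \<le> Suc (n X)" "j \<le> Suc (n X)" "i + 2 \<le> j \<or> j + 2 \<le> i"
  shows "separated n (point n X i) (point n X j)"
proof -
  have False if "adjacent (gamma n) (point n X i) (point n X j)"
    using that
  proof (rule adjacent_gammaE)
    fix Z l assume "l \<le> n Z"
      "{point n X i, point n X j} = {point n Z l, point n Z (Suc l)}"
    moreover have "n Z \<ge> 1" "n X \<ge> 1" using assms by auto
    ultimately show False
      using assms(2-) by (auto simp: doubleton_eq_iff point_def split: if_splits)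
  qed
  then show ?thesis
    using assms by (auto simp: separated_def point_def split: if_splits)
qed

text \<open>The route through \<open>Hub_u\<close> has length \<open>i + j\<close>, the one through
  \<open>Hub_v\<close> has length \<open>n X + n Y + 2 - (i + j)\<close>; the bounds make both at
  least 2.\<close>

lemma separated_diff:
  assumes "\<forall>X. n X \<ge> 1" "X \<noteq> Y" "i \<le> Suc (n X)" "j \<le> Suc (n Y)" "2 \<le> i + j" "i + j \<le> n X + n Y"
  shows "separated n (point n X i) (point n Y j)"
proof -
  have False if "adjacent (gamma n) (point n X i) (point n Y j)"
    using that
  proof (rule adjacent_gammaE)
    fix Z l assume "l \<le> n Z"
      "{point n X i, point n Y j} = {point n Z l, point n Z (Suc l)}"
    moreover have "n Z \<ge> 1" "n X \<ge> 1" "n Y \<ge> 1" using assms by auto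
    ultimately show False
      using assms(2-) by (auto simp: doubleton_eq_iff point_def split: if_splits)
  qed
  then show ?thesis
    using assms by (auto simp: separated_def point_def split: if_splits)
qed

section \<open>Two families of Eulerian circuits and their positions over time\<close>

text \<open>
  The start vertex is number k of branch X, with 0 and n X + 1 the hubs.  The
  orders in which the three other branches are traversed in the avoidance lemmas below were
  found by enumeration for small c.
\<close>

definition forward :: "(branch \<Rightarrow> nat) \<Rightarrow> branch \<Rightarrow> branch \<Rightarrow> branch \<Rightarrow> branch \<Rightarrow> nat \<Rightarrow> gamma_vertex list" where
  "forward n X Y Z W k = (((arc n X k (Suc (n X)) @ tl (rev (arc n Y 0 (Suc (n Y))))) @
     tl (arc n Z 0 (Suc (n Z)))) @ tl (rev (arc n W 0 (Suc (n W))))) @ tl (arc n X 0 k)"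

text \<open>For \<open>k \<le> Suc (n X)\<close> this is the reversal of
  \<open>forward n X W Z Y k\<close>. Exchanging the hubs, which sends coordinate \<open>k\<close>
  to \<open>n X + 1 - k\<close>, turns it into a forward circuit with the branches in the same
  order.\<close>

definition backward :: "(branch \<Rightarrow> nat) \<Rightarrow> branch \<Rightarrow> branch \<Rightarrow> branch \<Rightarrow> branch \<Rightarrow> nat \<Rightarrow> gamma_vertex list" where
  "backward n X Y Z W k = (((rev (arc n X 0 k) @ tl (arc n Y 0 (Suc (n Y)))) @
     tl (rev (arc n Z 0 (Suc (n Z))))) @ tl (arc n W 0 (Suc (n W)))) @ tl (rev (arc n X k (Suc (n X))))"

lemma set_arc: "j \<le> Suc (n X) \<Longrightarrow> set (arc n X i j) \<subseteq> verts (gamma n)"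
  by (fastforce simp: arc_def verts_gamma simp del: upt_Suc)

lemma set_join: "set xs \<subseteq> V \<Longrightarrow> set ys \<subseteq> V \<Longrightarrow> set (xs @ tl ys) \<subseteq> V"
  by (cases ys) auto

text \<open>\<open>Y\<close>, \<open>Z\<close>, \<open>W\<close> are full legs, and the first and
  last legs together make up \<open>X\<close>; joining and reversing preserve the edges.\<close>

lemma eulerian_forward:
  assumes "distinct [X, Y, Z, W]" "k \<le> Suc (n X)"
  shows "eulerian_circuit (gamma n) (point n X k) (forward n X Y Z W k)"
proof -
  have "mset (walk_edges (forward n X Y Z W k)) = edges (gamma n)"
    using assms(2) walk_edges_arc_split[of 0 k "Suc (n X)" n X] unfolding edges_gamma[OF assms(1)]
    by (simp add: branch_path_arc forward_def walk_edges_join nth_join hd_rev last_rev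
        mset_walk_edges_rev del: append_assoc)
  moreover have "set (forward n X Y Z W k) \<subseteq> verts (gamma n)"
    unfolding forward_def using assms(2) by (intro set_join) (simp_all add: set_arc)
  moreover have "hd (forward n X Y Z W k) = point n X k" "last (forward n X Y Z W k) = point n X k"
    "forward n X Y Z W k \<noteq> []"
    using assms(2) by (simp_all add: forward_def nth_join hd_rev last_rev del: append_assoc)
  ultimately show ?thesis
    by (simp add: eulerian_circuit_def)
qed

lemma eulerian_backward:
  assumes "distinct [X, Y, Z, W]" "k \<le> Suc (n X)"
  shows "eulerian_circuit (gamma n) (point n X k) (backward n X Y Z W k)"
proof -
  have "mset (walk_edges (backward n X Y Z W k)) = edges (gamma n)"
    using assms(2) walk_edges_arc_split[of 0 k "Suc (n X)" n X] unfolding edges_gamma[OF assms(1)]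
    by (simp add: branch_path_arc backward_def walk_edges_join nth_join hd_rev last_rev
        mset_walk_edges_rev del: append_assoc)
  moreover have "set (backward n X Y Z W k) \<subseteq> verts (gamma n)"
    unfolding backward_def using assms(2) by (intro set_join) (simp_all add: set_arc)
  moreover have "hd (backward n X Y Z W k) = point n X k" "last (backward n X Y Z W k) = point n X k"
    "backward n X Y Z W k \<noteq> []"
    using assms(2) by (simp_all add: backward_def nth_join hd_rev last_rev del: append_assoc)
  ultimately show ?thesis
    by (simp add: eulerian_circuit_def)
qed

text \<open>\<open>t + k\<close> is the distance travelled when counted from \<open>Hub_u\<close>
  along \<open>X\<close>, and the constants are cumulative branch lengths, a branch with m internal
  vertices having m + 1 edges. A hub fits the bounds of both adjoining legs.\<close>

lemma nth_forward:
  assumes "k \<le> Suc (n X)" "t \<le> n X + n Y + n Z + n W + 4"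
  obtains "t + k \<le> n X + 1" "forward n X Y Z W k ! t = point n X (t + k)"
  | "n X + 1 \<le> t + k" "t + k \<le> n X + n Y + 2"
    "forward n X Y Z W k ! t = point n Y (n X + n Y + 2 - (t + k))"
  | "n X + n Y + 2 \<le> t + k" "t + k \<le> n X + n Y + n Z + 3"
    "forward n X Y Z W k ! t = point n Z (t + k - (n X + n Y + 2))"
  | "n X + n Y + n Z + 3 \<le> t + k" "t + k \<le> n X + n Y + n Z + n W + 4"
    "forward n X Y Z W k ! t = point n W (n X + n Y + n Z + n W + 4 - (t + k))"
  | "n X + n Y + n Z + n W + 4 \<le> t + k" "t \<le> n X + n Y + n Z + n W + 4"
    "forward n X Y Z W k ! t = point n X (t + k - (n X + n Y + n Z + n W + 4))"
proof -
  \<comment> \<open>The length of the first leg; naming it keeps truncated subtraction out of the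
    case bounds.\<close>
  define e where "e = Suc (n X) - k"
  have e: "Suc (n X) = k + e"
    using assms(1) by (simp add: e_def)
  have [simp]: "Suc (n X) - k = e"
    by (simp add: e_def)
  consider "t \<le> e"
  | "e < t" "t \<le> e + n Y + 1"
  | "e + n Y + 1 < t" "t \<le> e + n Y + n Z + 2"
  | "e + n Y + n Z + 2 < t" "t \<le> e + n Y + n Z + n W + 3"
  | "e + n Y + n Z + n W + 3 < t"
    by linarith
  then show thesis
  proof cases
    case 1
    have "k + t = t + k"
      using 1 assms e by linarith
    moreover have "forward n X Y Z W k ! t = point n X (k + t)"
      using 1 assms by (simp add: forward_def nth_join hd_rev last_rev nth_arc nth_rev_arc del: append_assoc)
    ultimately show ?thesis
      using 1 assms e by (intro that(1)) (simp_all add: add.commute)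
  next
    case 2
    have "Suc (n Y) - (t - e) = n X + n Y + 2 - (t + k)"
      using 2 assms e by linarith
    moreover have "forward n X Y Z W k ! t = point n Y (Suc (n Y) - (t - e))"
      using 2 assms by (simp add: forward_def nth_join hd_rev last_rev nth_arc nth_rev_arc del: append_assoc)
    ultimately show ?thesis
      using 2 assms e by (intro that(2)) simp_all
  next
    case 3
    have "t - (e + n Y + 1) = t + k - (n X + n Y + 2)"
      using 3 assms e by linarith
    moreover have "forward n X Y Z W k ! t = point n Z (t - (e + n Y + 1))"
      using 3 assms by (simp add: forward_def nth_join hd_rev last_rev nth_arc nth_rev_arc del: append_assoc)
    ultimately show ?thesis
      using 3 assms e by (intro that(3)) simp_all
  next
    case 4
    have "Suc (n W) - (t - (e + n Y + n Z + 2)) = n X + n Y + n Z + n W + 4 - (t + k)"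
      using 4 assms e by linarith
    moreover have "forward n X Y Z W k ! t = point n W (Suc (n W) - (t - (e + n Y + n Z + 2)))"
      using 4 assms by (simp add: forward_def nth_join hd_rev last_rev nth_arc nth_rev_arc del: append_assoc)
    ultimately show ?thesis
      using 4 assms e by (intro that(4)) simp_all
  next
    case 5
    have "t - (e + n Y + n Z + n W + 3) = t + k - (n X + n Y + n Z + n W + 4)"
      using 5 assms e by linarith
    moreover have "t - (e + n Y + n Z + n W + 3) \<le> k"
      using 5 assms e by linarith
    then have "forward n X Y Z W k ! t = point n X (t - (e + n Y + n Z + n W + 3))"
      using 5 assms by (simp add: numeral_3_eq_3 forward_def nth_join hd_rev last_rev nth_arc nth_rev_arc del: append_assoc)
    ultimately show ?thesis
      using 5 assms e by (intro that(5)) simp_all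
  qed
qed

text \<open>The first leg now reaches \<open>Hub_u\<close> at time \<open>k\<close>, so the
  remaining legs are timed from \<open>k\<close>.\<close>

lemma nth_backward:
  assumes "k \<le> Suc (n X)" "t \<le> n X + n Y + n Z + n W + 4"
  obtains "t \<le> k" "backward n X Y Z W k ! t = point n X (k - t)"
  | "k \<le> t" "t \<le> k + n Y + 1"
    "backward n X Y Z W k ! t = point n Y (t - k)"
  | "k + n Y + 1 \<le> t" "t \<le> k + n Y + n Z + 2"
    "backward n X Y Z W k ! t = point n Z (k + n Y + n Z + 2 - t)"
  | "k + n Y + n Z + 2 \<le> t" "t \<le> k + n Y + n Z + n W + 3"
    "backward n X Y Z W k ! t = point n W (t - (k + n Y + n Z + 2))"
  | "k + n Y + n Z + n W + 3 \<le> t" "t \<le> n X + n Y + n Z + n W + 4"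
    "backward n X Y Z W k ! t = point n X (k + n X + n Y + n Z + n W + 4 - t)"
proof -
  define e where "e = Suc (n X) - k"
  have e: "Suc (n X) = k + e"
    using assms(1) by (simp add: e_def)
  have [simp]: "Suc (n X) - k = e"
    by (simp add: e_def)
  consider "t \<le> k"
  | "k < t" "t \<le> k + n Y + 1"
  | "k + n Y + 1 < t" "t \<le> k + n Y + n Z + 2"
  | "k + n Y + n Z + 2 < t" "t \<le> k + n Y + n Z + n W + 3"
  | "k + n Y + n Z + n W + 3 < t"
    by linarith
  then show thesis
  proof cases
    case 1
    have "k - t = k - t"
      using 1 assms e by linarith
    moreover have "backward n X Y Z W k ! t = point n X (k - t)"
      using 1 assms by (simp add: backward_def nth_join hd_rev last_rev nth_arc nth_rev_arc del: append_assoc)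
    ultimately show ?thesis
      using 1 assms e by (intro that(1)) simp_all
  next
    case 2
    have "t - k = t - k"
      using 2 assms e by linarith
    moreover have "backward n X Y Z W k ! t = point n Y (t - k)"
      using 2 assms by (simp add: backward_def nth_join hd_rev last_rev nth_arc nth_rev_arc del: append_assoc)
    ultimately show ?thesis
      using 2 assms e by (intro that(2)) simp_all
  next
    case 3
    have "Suc (n Z) - (t - (k + n Y + 1)) = k + n Y + n Z + 2 - t"
      using 3 assms e by linarith
    moreover have "backward n X Y Z W k ! t = point n Z (Suc (n Z) - (t - (k + n Y + 1)))"
      using 3 assms by (simp add: backward_def nth_join hd_rev last_rev nth_arc nth_rev_arc del: append_assoc)
    ultimately show ?thesis
      using 3 assms e by (intro that(3)) simp_all
  next
    case 4
    have "t - (k + n Y + n Z + 2) = t - (k + n Y + n Z + 2)"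
      using 4 assms e by linarith
    moreover have "backward n X Y Z W k ! t = point n W (t - (k + n Y + n Z + 2))"
      using 4 assms by (simp add: backward_def nth_join hd_rev last_rev nth_arc nth_rev_arc del: append_assoc)
    ultimately show ?thesis
      using 4 assms e by (intro that(4)) simp_all
  next
    case 5
    have "Suc (n X) - (t - (k + n Y + n Z + n W + 3)) = k + n X + n Y + n Z + n W + 4 - t"
      using 5 assms e by linarith
    moreover have "t - (k + n Y + n Z + n W + 3) \<le> e"
      using 5 assms e by linarith
    then have "backward n X Y Z W k ! t = point n X (Suc (n X) - (t - (k + n Y + n Z + n W + 3)))"
      using 5 assms by (simp add: numeral_3_eq_3 backward_def nth_join hd_rev last_rev nth_arc nth_rev_arc del: append_assoc)
    ultimately show ?thesis
      using 5 assms e by (intro that(5)) simp_all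
  qed
qed

section \<open>Avoiding pairs for each range of start vertices\<close>

lemma avoidingI:
  assumes "distinct [X, Y, Z, W]"
    and "\<And>t. 1 \<le> t \<Longrightarrow> t \<le> n X + n Y + n Z + n W + 3 \<Longrightarrow> separated n (p ! t) (q ! t)"
  shows "avoiding (gamma n) p q"
  unfolding avoiding_def size_edges_gamma[OF assms(1)] using assms(2) by (auto simp: separated_def)

text \<open>Both circuits run through \<open>Z\<close> and \<open>W\<close> in the same directions,
  the backward one \<open>7 - 2 * k \<ge> 3\<close> steps ahead, and their visits to
  \<open>Y\<close> are disjoint in time. The values \<open>k = 0\<close> and \<open>k = 2\<close>
  are the hubs.\<close>

lemma avoiding_from_short_branch:
  assumes "distinct [X, Y, Z, W]" "\<forall>X. n X \<ge> 1"
    and "n X = 1" "n Y = 4" "n Z = c" "n W = c" "c \<ge> 4" "k \<le> 2"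
  shows "avoiding (gamma n) (forward n X Y Z W k) (backward n X Z W Y k)"
proof (rule avoidingI[OF assms(1)])
  fix t assume t: "1 \<le> t" "t \<le> n X + n Y + n Z + n W + 3"
  have k: "k \<le> Suc (n X)" "t \<le> n X + n Y + n Z + n W + 4" "t \<le> n X + n Z + n W + n Y + 4"
    using t assms(3-) by linarith+
  have d: "X \<noteq> Y" "X \<noteq> Z" "X \<noteq> W" "Y \<noteq> Z" "Y \<noteq> W" "Z \<noteq> W"
    using assms(1) by auto
  note * = assms(3-) t
  show "separated n (forward n X Y Z W k ! t) (backward n X Z W Y k ! t)"
    \<comment> \<open>Each of the 25 pairs of legs is impossible by timing, or lies on one branch
      with coordinates at least 2 apart, or lies on two branches with a coordinate sum in the
      admissible range.\<close>
    by (rule nth_forward[OF k(1,2)]; rule nth_backward[OF k(1,3)]; simp only:;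
        insert *;
        (linarith | (rule separated_same[OF assms(2)]; linarith)
         | (rule separated_diff[OF assms(2)], (rule d d[symmetric])[1], linarith+)))
qed

text \<open>The lead on \<open>Z\<close> and \<open>W\<close> is
  \<open>n X + n Y + 2 - 2 * k\<close>, hence again \<open>7 - 2 * k \<ge> 3\<close>.\<close>

lemma avoiding_from_four_branch_lower:
  assumes "distinct [X, Y, Z, W]" "\<forall>X. n X \<ge> 1"
    and "n X = 4" "n Y = 1" "n Z = c" "n W = c" "c \<ge> 4" "1 \<le> k" "k \<le> 2"
  shows "avoiding (gamma n) (forward n X Y Z W k) (backward n X Z W Y k)"
proof (rule avoidingI[OF assms(1)])
  fix t assume t: "1 \<le> t" "t \<le> n X + n Y + n Z + n W + 3"
  have k: "k \<le> Suc (n X)" "t \<le> n X + n Y + n Z + n W + 4" "t \<le> n X + n Z + n W + n Y + 4"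
    using t assms(3-) by linarith+
  have d: "X \<noteq> Y" "X \<noteq> Z" "X \<noteq> W" "Y \<noteq> Z" "Y \<noteq> W" "Z \<noteq> W"
    using assms(1) by auto
  note * = assms(3-) t
  show "separated n (forward n X Y Z W k ! t) (backward n X Z W Y k ! t)"
    by (rule nth_forward[OF k(1,2)]; rule nth_backward[OF k(1,3)]; simp only:;
        insert *;
        (linarith | (rule separated_same[OF assms(2)]; linarith)
         | (rule separated_diff[OF assms(2)], (rule d d[symmetric])[1], linarith+)))
qed

text \<open>Mirror image of the lower case under exchange of the hubs, with \<open>k\<close>
  replaced by \<open>5 - k\<close>.\<close>

lemma avoiding_from_four_branch_upper:
  assumes "distinct [X, Y, Z, W]" "\<forall>X. n X \<ge> 1"
    and "n X = 4" "n Y = 1" "n Z = c" "n W = c" "c \<ge> 4" "3 \<le> k" "k \<le> 4"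
  shows "avoiding (gamma n) (forward n X Z W Y k) (backward n X Y Z W k)"
proof (rule avoidingI[OF assms(1)])
  fix t assume t: "1 \<le> t" "t \<le> n X + n Y + n Z + n W + 3"
  have k: "k \<le> Suc (n X)" "t \<le> n X + n Z + n W + n Y + 4" "t \<le> n X + n Y + n Z + n W + 4"
    using t assms(3-) by linarith+
  have d: "X \<noteq> Y" "X \<noteq> Z" "X \<noteq> W" "Y \<noteq> Z" "Y \<noteq> W" "Z \<noteq> W"
    using assms(1) by auto
  note * = assms(3-) t
  show "separated n (forward n X Z W Y k ! t) (backward n X Y Z W k ! t)"
    by (rule nth_forward[OF k(1,2)]; rule nth_backward[OF k(1,3)]; simp only:;
        insert *;
        (linarith | (rule separated_same[OF assms(2)]; linarith)
         | (rule separated_diff[OF assms(2)], (rule d d[symmetric])[1], linarith+)))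
qed

text \<open>The forward circuit enters \<open>Y\<close> at least 2 steps after the other has left
  it. On \<open>W\<close> the backward circuit leads by \<open>c + 6 - 2 * k\<close>, on
  \<open>Z\<close> the forward one leads by \<open>2 * k\<close>.\<close>

lemma avoiding_from_long_branch_near_u:
  assumes "distinct [X, Y, Z, W]" "\<forall>X. n X \<ge> 1"
    and "n X = c" "n Y = 1" "n Z = 4" "n W = c" "c \<ge> 4" "1 \<le> k" "2 * k + 3 \<le> c"
  shows "avoiding (gamma n) (forward n X Y Z W k) (backward n X Y W Z k)"
proof (rule avoidingI[OF assms(1)])
  fix t assume t: "1 \<le> t" "t \<le> n X + n Y + n Z + n W + 3"
  have k: "k \<le> Suc (n X)" "t \<le> n X + n Y + n Z + n W + 4" "t \<le> n X + n Y + n W + n Z + 4"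
    using t assms(3-) by linarith+
  have d: "X \<noteq> Y" "X \<noteq> Z" "X \<noteq> W" "Y \<noteq> Z" "Y \<noteq> W" "Z \<noteq> W"
    using assms(1) by auto
  note * = assms(3-) t
  show "separated n (forward n X Y Z W k ! t) (backward n X Y W Z k ! t)"
    by (rule nth_forward[OF k(1,2)]; rule nth_backward[OF k(1,3)]; simp only:;
        insert *;
        (linarith | (rule separated_same[OF assms(2)]; linarith)
         | (rule separated_diff[OF assms(2)], (rule d d[symmetric])[1], linarith+)))
qed

text \<open>On \<open>Z\<close> and \<open>W\<close> the backward circuit leads by
  \<open>c + 3 - 2 * k \<ge> 2\<close>. The bound \<open>c \<le> 2 * k + 2\<close> makes its first
  arrival at \<open>Hub_v\<close> at least 2 steps later than that of the forward circuit.\<close>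

lemma avoiding_from_long_branch_middle_u:
  assumes "distinct [X, Y, Z, W]" "\<forall>X. n X \<ge> 1"
    and "n X = c" "n Y = 1" "n Z = 4" "n W = c" "c \<ge> 4" "1 \<le> k" "2 * k \<le> c + 1" "c \<le> 2 * k + 2"
  shows "avoiding (gamma n) (forward n X Y Z W k) (backward n X Z W Y k)"
proof (rule avoidingI[OF assms(1)])
  fix t assume t: "1 \<le> t" "t \<le> n X + n Y + n Z + n W + 3"
  have k: "k \<le> Suc (n X)" "t \<le> n X + n Y + n Z + n W + 4" "t \<le> n X + n Z + n W + n Y + 4"
    using t assms(3-) by linarith+
  have d: "X \<noteq> Y" "X \<noteq> Z" "X \<noteq> W" "Y \<noteq> Z" "Y \<noteq> W" "Z \<noteq> W"
    using assms(1) by auto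
  note * = assms(3-) t
  show "separated n (forward n X Y Z W k ! t) (backward n X Z W Y k ! t)"
    by (rule nth_forward[OF k(1,2)]; rule nth_backward[OF k(1,3)]; simp only:;
        insert *;
        (linarith | (rule separated_same[OF assms(2)]; linarith)
         | (rule separated_diff[OF assms(2)], (rule d d[symmetric])[1], linarith+)))
qed

text \<open>Mirror image of the middle case on the side of \<open>Hub_u\<close>, with
  \<open>k\<close> replaced by \<open>c + 1 - k\<close>.\<close>

lemma avoiding_from_long_branch_middle_v:
  assumes "distinct [X, Y, Z, W]" "\<forall>X. n X \<ge> 1"
    and "n X = c" "n Y = 1" "n Z = 4" "n W = c" "c \<ge> 4" "k \<le> c" "c + 1 \<le> 2 * k" "2 * k \<le> c + 4"
  shows "avoiding (gamma n) (forward n X Z W Y k) (backward n X Y Z W k)"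
proof (rule avoidingI[OF assms(1)])
  fix t assume t: "1 \<le> t" "t \<le> n X + n Y + n Z + n W + 3"
  have k: "k \<le> Suc (n X)" "t \<le> n X + n Z + n W + n Y + 4" "t \<le> n X + n Y + n Z + n W + 4"
    using t assms(3-) by linarith+
  have d: "X \<noteq> Y" "X \<noteq> Z" "X \<noteq> W" "Y \<noteq> Z" "Y \<noteq> W" "Z \<noteq> W"
    using assms(1) by auto
  note * = assms(3-) t
  show "separated n (forward n X Z W Y k ! t) (backward n X Y Z W k ! t)"
    by (rule nth_forward[OF k(1,2)]; rule nth_backward[OF k(1,3)]; simp only:;
        insert *;
        (linarith | (rule separated_same[OF assms(2)]; linarith)
         | (rule separated_diff[OF assms(2)], (rule d d[symmetric])[1], linarith+)))
qed

text \<open>Mirror image of the case near \<open>Hub_u\<close>, with \<open>k\<close> replaced by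
  \<open>c + 1 - k\<close>.\<close>

lemma avoiding_from_long_branch_near_v:
  assumes "distinct [X, Y, Z, W]" "\<forall>X. n X \<ge> 1"
    and "n X = c" "n Y = 1" "n Z = 4" "n W = c" "c \<ge> 4" "k \<le> c" "c + 5 \<le> 2 * k"
  shows "avoiding (gamma n) (forward n X Y W Z k) (backward n X Y Z W k)"
proof (rule avoidingI[OF assms(1)])
  fix t assume t: "1 \<le> t" "t \<le> n X + n Y + n Z + n W + 3"
  have k: "k \<le> Suc (n X)" "t \<le> n X + n Y + n W + n Z + 4" "t \<le> n X + n Y + n Z + n W + 4"
    using t assms(3-) by linarith+
  have d: "X \<noteq> Y" "X \<noteq> Z" "X \<noteq> W" "Y \<noteq> Z" "Y \<noteq> W" "Z \<noteq> W"
    using assms(1) by auto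
  note * = assms(3-) t
  show "separated n (forward n X Y W Z k ! t) (backward n X Y Z W k ! t)"
    by (rule nth_forward[OF k(1,2)]; rule nth_backward[OF k(1,3)]; simp only:;
        insert *;
        (linarith | (rule separated_same[OF assms(2)]; linarith)
         | (rule separated_diff[OF assms(2)], (rule d d[symmetric])[1], linarith+)))
qed

section \<open>Assembling the avoidance index\<close>

lemma has_avoiding_circuits_gamma:
  assumes "distinct [X, Y, Z, W]" "distinct [X, Y', Z', W']" "k \<le> Suc (n X)"
    and "avoiding (gamma n) (forward n X Y Z W k) (backward n X Y' Z' W' k)"
  shows "has_avoiding_circuits (gamma n) (point n X k) 2"
  using eulerian_forward[of X Y Z W k n] eulerian_backward[of X Y' Z' W' k n]
    size_edges_gamma[OF assms(1), of n] assms
  by (intro has_avoiding_circuits_two) auto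

theorem theorem8:
  fixes c :: nat
  assumes "c \<ge> 4"
  shows "avoidance_index (Gamma 1 4 c c) = 2"
proof -
  define n :: "branch \<Rightarrow> nat" where "n = case_branch 1 4 c c"
  have n [simp]: "n A = 1" "n B = 4" "n C = c" "n D = c"
    by (simp_all add: n_def)
  have pos: "\<forall>X. n X \<ge> 1"
    using assms by (auto simp: n_def split: branch.split)
  \<comment> \<open>\<open>W\<close> is the other long branch, so this serves start vertices on
    \<open>C\<close> and on \<open>D\<close>.\<close>
  have long: "has_avoiding_circuits (gamma n) (point n X k) 2"
    if X: "distinct [X, A, B, W]" "n X = c" "n W = c" "1 \<le> k" "k \<le> c" for X W k
  proof -
    note av = avoiding_from_long_branch_near_u[OF X(1) pos X(2) n(1,2) X(3) assms]
      avoiding_from_long_branch_middle_u[OF X(1) pos X(2) n(1,2) X(3) assms]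
      avoiding_from_long_branch_middle_v[OF X(1) pos X(2) n(1,2) X(3) assms]
      avoiding_from_long_branch_near_v[OF X(1) pos X(2) n(1,2) X(3) assms]
    have d: "distinct [X, A, W, B]" "distinct [X, B, W, A]" and k: "k \<le> Suc (n X)"
      using X by auto
    consider "2 * k + 3 \<le> c" | "2 * k \<le> c + 1" "c \<le> 2 * k + 2"
      | "c + 1 \<le> 2 * k" "2 * k \<le> c + 4" | "c + 5 \<le> 2 * k"
      by linarith
    then show ?thesis
      by cases (use X k d av has_avoiding_circuits_gamma in \<open>metis+\<close>)
  qed
  have "has_avoiding_circuits (gamma n) x 2" if "x \<in> verts (gamma n)" for x
  proof -
    obtain X i where Xi: "x = point n X i" "i \<le> Suc (n X)"
      using \<open>x \<in> verts (gamma n)\<close> unfolding verts_gamma[of n] by blast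
    \<comment> \<open>Hubs are recoordinatised as points 0 and 2 of \<open>A\<close>, so the other
      branches only need internal start vertices.\<close>
    obtain X k where x: "x = point n X k" and k: "X = A \<and> k \<le> 2 \<or> X \<noteq> A \<and> 1 \<le> k \<and> k \<le> n X"
    proof -
      have "Hub_u = point n A 0" "Hub_v = point n A 2"
        by (simp_all add: point_def)
      then show thesis
        using that[of A 0] that[of A 2] that[of X i] Xi
        by (cases "i = 0"; cases "i = Suc (n X)"; cases "X = A") auto
    qed
    show ?thesis
    proof (cases X)
      case A
      show ?thesis
        unfolding x A using k A
        by (intro has_avoiding_circuits_gamma[OF _ _ _ avoiding_from_short_branch[of A B C D n c]])
          (use pos assms in auto)
    next
      case B
      show ?thesis
      proof (cases "k \<le> 2")
        case True
        then show ?thesis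
          unfolding x B using k B
          by (intro has_avoiding_circuits_gamma[OF _ _ _ avoiding_from_four_branch_lower[of B A C D n c]])
            (use pos assms in auto)
      next
        case False
        then show ?thesis
          unfolding x B using k B
          by (intro has_avoiding_circuits_gamma[OF _ _ _ avoiding_from_four_branch_upper[of B A C D n c]])
            (use pos assms in auto)
      qed
    next
      case C
      with k x long[of C D k] show ?thesis by auto
    next
      case D
      with k x long[of D C k] show ?thesis by auto
    qed
  qed
  moreover have "k \<le> 2" if "\<forall>x\<in>verts (gamma n). has_avoiding_circuits (gamma n) x k" for k
  proof -
    \<comment> \<open>Coordinate 1 is the only internal vertex of \<open>A\<close>.\<close>
    have "point n A 1 \<in> verts (gamma n)"
      unfolding verts_gamma[of n] by (intro CollectI exI[of _ A] exI[of _ 1]) simp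
    then have "has_avoiding_circuits (gamma n) (point n A 1) k"
      using that by blast
    moreover have "{y. adjacent (gamma n) (point n A 1) y} \<subseteq> {Hub_u, Hub_v}"
    proof (rule subsetI, unfold mem_Collect_eq)
      fix y assume "adjacent (gamma n) (point n A 1) y"
      then show "y \<in> {Hub_u, Hub_v}"
        by (rule adjacent_gammaE) (auto simp: doubleton_eq_iff point_def split: if_splits)
    qed
    moreover have "size (edges (gamma n)) \<ge> 2"
      using size_edges_gamma[of A B C D n] by simp
    ultimately have "k \<le> card {Hub_u, Hub_v}"
      by (intro has_avoiding_circuits_le_degree) auto
    then show ?thesis by simp
  qed
  ultimately have "avoidance_index (gamma n) = 2"
    unfolding avoidance_index_def by (intro Greatest_equality) auto
  then show ?thesis by simp
qed

end
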